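(* Let $F$ be a field, $a,a'\in F$ and $A\in F^{n\times n}$. Then the following hold. (a) $A\in C(A,a)$ if and only if $a=1$ or $A^2=0$. (b) If $B\in C(A,a)$ and $B'\in C(A,a')$, then $BB'$ and $B'B$ both lie in $C(A,aa')$. (c) If $a\neq 0$, then for $B\in F^{n\times n}$: $B\in C(A,a)$ if and only if $A\in C(B,a^{-1})$. (d) If $A\neq 0_{n\times n}$, then $I_n\in C(A,a)$ if and only if $a=1$. (e) If $a\neq 0$, then for $B\in F^{n\times n}$: $B\in C(A,a)$ if and only if $B^t\in C(A^t,a^{-1})$.
   Context: $F^{n\times n}$ denotes the $n\times n$ matrices over $F$. For $A\in F^{n\times n}$ and $a\in F$, $C(A,a):=\{B\in F^{n\times n}\mid AB=aBA\}$. $A^t$ denotes the transpose of $A$. *)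

theory Defs
  imports "Jordan_Normal_Form.Matrix"
begin

text \<open>
  The set \<open>C(A, a)\<close> of \<open>n \<times> n\<close> matrices \<open>B\<close> with \<open>A B = a B A\<close>. The dimension \<open>n\<close> is a
  parameter because the type of matrices does not determine it.
\<close>

definition twisted_centralizer :: "nat \<Rightarrow> 'a :: field mat \<Rightarrow> 'a \<Rightarrow> 'a mat set" where
  "twisted_centralizer n A a = {B \<in> carrier_mat n n. A * B = a \<cdot>\<^sub>m (B * A)}"

end

theory Submission
  imports Defs
begin

text \<open>
  The relation \<open>A B = a B A\<close> says that moving \<open>A\<close> from left to right past \<open>B\<close> costs the
  factor \<open>a\<close>. Moving \<open>A\<close> past a product costs the product of the factors
  (\<open>mult_in_twisted_centralizer\<close>), which is commutative, so the order of the two matrices does not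
  matter. Moving \<open>A\<close> back costs \<open>a\<^sup>-\<^sup>1\<close>, which exchanges the roles of \<open>A\<close> and \<open>B\<close>
  (\<open>twisted_centralizer_swap\<close>). Transposition reverses all products, so it also exchanges these
  roles, but without changing the factor (\<open>transpose_in_twisted_centralizer_iff\<close>). Transposing and
  inverting the factor therefore gives back the original relation. For \<open>B = A\<close> and for
  \<open>B = I\<close> the relation has the form \<open>M = a M\<close> with \<open>M = A\<^sup>2\<close> and \<open>M = A\<close> respectively, which
  over a field forces \<open>a = 1\<close> or \<open>M = 0\<close> (\<open>eq_smult_self_iff\<close>).
\<close>

lemma eq_smult_self_iff:
  fixes M :: "'a :: field mat"
  assumes M: "M \<in> carrier_mat n m"
  shows "M = a \<cdot>\<^sub>m M \<longleftrightarrow> a = 1 \<or> M = 0\<^sub>m n m"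
proof
  assume eq: "M = a \<cdot>\<^sub>m M"
  have "M = 0\<^sub>m n m" if "a \<noteq> 1"
  proof (rule eq_matI)
    fix i j assume ij: "i < dim_row (0\<^sub>m n m :: 'a mat)" "j < dim_col (0\<^sub>m n m :: 'a mat)"
    have "M $$ (i, j) = (a \<cdot>\<^sub>m M) $$ (i, j)"
      using eq by simp
    also have "\<dots> = a * M $$ (i, j)"
      using ij M by simp
    finally show "M $$ (i, j) = 0\<^sub>m n m $$ (i, j)"
      using that ij by simp
  qed (use M in auto)
  then show "a = 1 \<or> M = 0\<^sub>m n m" by blast
qed (use M in auto)

lemma smult_smult_mat:
  fixes M :: "'a :: semigroup_mult mat"
  shows "a \<cdot>\<^sub>m (b \<cdot>\<^sub>m M) = (a * b) \<cdot>\<^sub>m M"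
  by (rule eq_matI) (auto simp: mult.assoc)

lemma one_smult_mat:
  fixes M :: "'a :: monoid_mult mat"
  shows "1 \<cdot>\<^sub>m M = M"
  by (rule eq_matI) auto

lemma transpose_smult_mat: "(a \<cdot>\<^sub>m M)\<^sup>T = a \<cdot>\<^sub>m M\<^sup>T"
  by (rule eq_matI) auto

lemma eq_smult_iff_inverse_smult_eq:
  fixes M N :: "'a :: field mat"
  assumes "a \<noteq> 0"
  shows "M = a \<cdot>\<^sub>m N \<longleftrightarrow> N = inverse a \<cdot>\<^sub>m M"
  using assms by (auto simp: smult_smult_mat one_smult_mat)

lemma mult_in_twisted_centralizer:
  fixes A :: "'a :: field mat"
  assumes A: "A \<in> carrier_mat n n"
    and "B \<in> twisted_centralizer n A a" "B' \<in> twisted_centralizer n A a'"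
  shows "B * B' \<in> twisted_centralizer n A (a * a')"
proof -
  have B: "B \<in> carrier_mat n n" and AB: "A * B = a \<cdot>\<^sub>m (B * A)"
    and B': "B' \<in> carrier_mat n n" and AB': "A * B' = a' \<cdot>\<^sub>m (B' * A)"
    using assms by (auto simp: twisted_centralizer_def)
  have "A * (B * B') = a \<cdot>\<^sub>m (B * A) * B'"
    using assoc_mult_mat[OF A B B'] AB by simp
  also have "\<dots> = a \<cdot>\<^sub>m (B * (A * B'))"
    using mult_smult_assoc_mat[OF mult_carrier_mat[OF B A] B'] assoc_mult_mat[OF B A B'] by simp
  also have "\<dots> = a \<cdot>\<^sub>m (a' \<cdot>\<^sub>m (B * (B' * A)))"
    using mult_smult_distrib[OF B mult_carrier_mat[OF B' A]] AB' by simp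
  also have "\<dots> = (a * a') \<cdot>\<^sub>m (B * B' * A)"
    using assoc_mult_mat[OF B B' A] by (simp add: smult_smult_mat)
  finally show ?thesis
    using B B' by (simp add: twisted_centralizer_def)
qed

lemma twisted_centralizer_swap:
  fixes A B :: "'a :: field mat"
  assumes "A \<in> carrier_mat n n" "B \<in> carrier_mat n n" "a \<noteq> 0"
  shows "B \<in> twisted_centralizer n A a \<longleftrightarrow> A \<in> twisted_centralizer n B (inverse a)"
  using assms eq_smult_iff_inverse_smult_eq[of a "A * B" "B * A"]
  by (simp add: twisted_centralizer_def)

text \<open>
  Both sides express one equation, once transposed: \<open>A\<^sup>t B\<^sup>t = (B A)\<^sup>t\<close> and \<open>B\<^sup>t A\<^sup>t = (A B)\<^sup>t\<close>.
\<close>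

lemma transpose_in_twisted_centralizer_iff:
  fixes A B :: "'a :: field mat"
  assumes A: "A \<in> carrier_mat n n" and B: "B \<in> carrier_mat n n"
  shows "B\<^sup>T \<in> twisted_centralizer n A\<^sup>T a \<longleftrightarrow> A \<in> twisted_centralizer n B a"
proof -
  have "A\<^sup>T * B\<^sup>T = a \<cdot>\<^sub>m (B\<^sup>T * A\<^sup>T) \<longleftrightarrow> (B * A)\<^sup>T = (a \<cdot>\<^sub>m (A * B))\<^sup>T"
    by (simp only: transpose_mult[OF A B] transpose_mult[OF B A] transpose_smult_mat)
  then show ?thesis
    using A B by (simp add: twisted_centralizer_def)
qed

theorem theorem1p2:
  fixes A :: "'a :: field mat" and a a' :: 'a and n :: nat
  assumes "A \<in> carrier_mat n n"
  shows "(A \<in> twisted_centralizer n A a \<longleftrightarrow> a = 1 \<or> A ^\<^sub>m 2 = 0\<^sub>m n n) \<and>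
    (\<forall>B B'. B \<in> twisted_centralizer n A a \<longrightarrow> B' \<in> twisted_centralizer n A a' \<longrightarrow>
       B * B' \<in> twisted_centralizer n A (a * a') \<and> B' * B \<in> twisted_centralizer n A (a * a')) \<and>
    (a \<noteq> 0 \<longrightarrow> (\<forall>B \<in> carrier_mat n n.
       B \<in> twisted_centralizer n A a \<longleftrightarrow> A \<in> twisted_centralizer n B (inverse a))) \<and>
    (A \<noteq> 0\<^sub>m n n \<longrightarrow> (1\<^sub>m n \<in> twisted_centralizer n A a \<longleftrightarrow> a = 1)) \<and>
    (a \<noteq> 0 \<longrightarrow> (\<forall>B \<in> carrier_mat n n.
       B \<in> twisted_centralizer n A a \<longleftrightarrow>
       transpose_mat B \<in> twisted_centralizer n (transpose_mat A) (inverse a)))"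
proof (intro conjI allI impI ballI)
  have "A ^\<^sub>m 2 = A * A"
    using assms by (simp add: numeral_2_eq_2)
  then show "A \<in> twisted_centralizer n A a \<longleftrightarrow> a = 1 \<or> A ^\<^sub>m 2 = 0\<^sub>m n n"
    using assms eq_smult_self_iff[OF mult_carrier_mat[OF assms assms], of a]
    by (simp add: twisted_centralizer_def)
next
  fix B B'
  assume B: "B \<in> twisted_centralizer n A a" and B': "B' \<in> twisted_centralizer n A a'"
  show "B * B' \<in> twisted_centralizer n A (a * a')"
    by (rule mult_in_twisted_centralizer[OF assms B B'])
  show "B' * B \<in> twisted_centralizer n A (a * a')"
    using mult_in_twisted_centralizer[OF assms B' B] by (simp add: mult.commute)
next
  fix B :: "'a mat"
  assume "a \<noteq> 0" "B \<in> carrier_mat n n"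
  then show "B \<in> twisted_centralizer n A a \<longleftrightarrow> A \<in> twisted_centralizer n B (inverse a)"
    using twisted_centralizer_swap[OF assms] by blast
next
  assume "A \<noteq> 0\<^sub>m n n"
  then show "1\<^sub>m n \<in> twisted_centralizer n A a \<longleftrightarrow> a = 1"
    using assms eq_smult_self_iff[OF assms, of a] by (simp add: twisted_centralizer_def)
next
  fix B :: "'a mat"
  assume "a \<noteq> 0" and B: "B \<in> carrier_mat n n"
  then show "B \<in> twisted_centralizer n A a \<longleftrightarrow>
      B\<^sup>T \<in> twisted_centralizer n A\<^sup>T (inverse a)"
    using twisted_centralizer_swap[OF assms B] transpose_in_twisted_centralizer_iff[OF assms B]
    by blast
qed

end
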